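(* Let $\omega = \tfrac12 + \tfrac{\sqrt{-11}}{2}$ and $\mathcal{E}_{-11} = \{ n \in \mathbb{Z}[\omega] : |n|^2 \le 5\} \setminus \{2,-2\}$. For every $n \in \mathbb{Z}[\omega] \setminus \mathcal{E}_{-11}$ there exist nonzero $a,b,c \in \mathbb{Z}[\omega]$ with $\frac{4}{n} = \frac1a + \frac1b + \frac1c$.
   Context: $\mathbb{Z}[\omega]$ is the ring of integers of $\mathbb{Q}(\sqrt{-11})$; for $n = x + y\omega$ with $x,y\in\mathbb{Z}$, $|n|^2 = x^2 + xy + 3y^2$. *)

theory Defs
  imports Complex_Main
begin

definition omega :: complex where
  "omega = 1 / 2 + csqrt (- 11) / 2"

(* The integer span of 1 and omega; it is closed under multiplication because
   omega^2 = omega - 3 (see Z_omega_mult), so it is the whole ring Z[omega]. *)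
definition Z_omega :: "complex set" where
  "Z_omega = {of_int x + of_int y * omega | x y :: int. True}"

definition exceptional_set :: "complex set" where
  "exceptional_set = {n \<in> Z_omega. (cmod n)\<^sup>2 \<le> 5} - {2, - 2}"

lemma omega_eq_Complex: "omega = Complex (1 / 2) (sqrt 11 / 2)"
  by (simp add: omega_def complex_eq_iff)

lemma omega_square: "omega * omega = omega - 3"
  by (simp add: omega_eq_Complex complex_eq_iff)

lemma Z_omega_mult:
  assumes "m \<in> Z_omega" "n \<in> Z_omega"
  shows "m * n \<in> Z_omega"
proof -
  obtain x y where m: "m = of_int x + of_int y * omega"
    using assms(1) by (auto simp: Z_omega_def)
  obtain u v where n: "n = of_int u + of_int v * omega"
    using assms(2) by (auto simp: Z_omega_def)
  have "m * n = of_int x * of_int u + (of_int x * of_int v + of_int y * of_int u) * omega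
      + of_int y * of_int v * (omega * omega)"
    by (simp add: m n algebra_simps)
  also have "\<dots> = of_int (x * u - 3 * (y * v)) + of_int (x * v + y * u + y * v) * omega"
    by (simp add: omega_square algebra_simps)
  finally show ?thesis
    unfolding Z_omega_def by blast
qed

lemma cmod_Z_omega_square:
  "(cmod (of_int x + of_int y * omega))\<^sup>2 = of_int (x\<^sup>2 + x * y + 3 * y\<^sup>2)"
proof -
  have "sqrt 11 * (sqrt 11 * z) = 11 * z" for z :: real
    by (simp flip: mult.assoc)
  then show ?thesis
    unfolding cmod_power2 by (simp add: omega_eq_Complex power2_eq_square field_simps)
qed

end

theory Submission
  imports Defs
begin

text \<open>
  If \<open>4 a = n + r\<close>, then \<open>4 / n - 1 / a = r / (n a)\<close>, and a fraction \<open>r / (d e k)\<close> with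
  \<open>r\<close> dividing \<open>d + e\<close> is a sum of two unit fractions. Up to sign every odd \<open>n\<close> is congruent
  modulo 4 to \<open>-r\<close> for one of \<open>r = 1, p, q, (1 - \<omega>) (2 - \<omega>)\<close>, where
  \<open>p \<in> {\<omega>, 1 - \<omega>}\<close> has norm 3 and \<open>q \<in> {1 + \<omega>, 2 - \<omega>}\<close> has norm 5.
  Modulo \<open>p\<close> we have \<open>a \<equiv> n\<close>, and modulo \<open>q\<close> we have \<open>a \<equiv> -n\<close>; hence if \<open>n\<close> is prime
  to \<open>r\<close>, one of \<open>n\<close>, \<open>a\<close>, \<open>n a\<close> is always congruent to \<open>1\<close> or \<open>-1\<close> modulo \<open>r\<close>, so
  \<open>{d, e}\<close> can be chosen as a unit and one of these three. Common factors of \<open>n\<close> and \<open>r\<close>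
  also divide \<open>a\<close> and cancel.
\<close>

section \<open>Ring operations and norms in Z[omega]\<close>

lemma Z_omega_of_int [simp]: "of_int x \<in> Z_omega"
  unfolding Z_omega_def by (rule CollectI, rule exI[of _ x], rule exI[of _ 0]) simp

lemma Z_omega_numeral [simp]: "0 \<in> Z_omega" "1 \<in> Z_omega" "numeral k \<in> Z_omega"
  using Z_omega_of_int[of 0] Z_omega_of_int[of 1] Z_omega_of_int[of "numeral k"] by simp_all

lemma Z_omega_omega [simp]: "omega \<in> Z_omega"
  unfolding Z_omega_def by (rule CollectI, rule exI[of _ 0], rule exI[of _ 1]) simp

lemma Z_omega_add [simp]: "m \<in> Z_omega \<Longrightarrow> n \<in> Z_omega \<Longrightarrow> m + n \<in> Z_omega"
proof -
  assume "m \<in> Z_omega" "n \<in> Z_omega"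
  then obtain x y u v :: int where "m = of_int x + of_int y * omega" "n = of_int u + of_int v * omega"
    by (auto simp: Z_omega_def)
  then have "m + n = of_int (x + u) + of_int (y + v) * omega"
    by (simp add: algebra_simps)
  then show ?thesis unfolding Z_omega_def by blast
qed

lemma Z_omega_times [simp]: "m \<in> Z_omega \<Longrightarrow> n \<in> Z_omega \<Longrightarrow> m * n \<in> Z_omega"
  by (rule Z_omega_mult)

lemma Z_omega_uminus [simp]: "m \<in> Z_omega \<Longrightarrow> - m \<in> Z_omega"
  using Z_omega_times[OF Z_omega_of_int[of "-1"], of m] by simp

lemma Z_omega_diff [simp]: "m \<in> Z_omega \<Longrightarrow> n \<in> Z_omega \<Longrightarrow> m - n \<in> Z_omega"
  using Z_omega_add[of m "- n"] by simp

text \<open>The squared modulus is a value of the integral norm form, so once positive it is at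
  least 1.\<close>

lemma cmod_Z_omega_ge_1:
  assumes "z \<in> Z_omega" "z \<noteq> 0"
  shows "1 \<le> cmod z"
proof -
  obtain x y :: int where z: "z = of_int x + of_int y * omega"
    using assms(1) by (auto simp: Z_omega_def)
  let ?N = "x\<^sup>2 + x * y + 3 * y\<^sup>2"
  have N: "(cmod z)\<^sup>2 = of_int ?N"
    unfolding z by (rule cmod_Z_omega_square)
  have "0 < (cmod z)\<^sup>2"
    using assms(2) by simp
  then have "0 < ?N"
    unfolding N by linarith
  then have "1 \<le> (cmod z)\<^sup>2"
    unfolding N by linarith
  then show ?thesis
    using power_less_one_iff[of "cmod z" 2] by (simp add: not_less[symmetric])
qed

lemma cmod_square_omega_factors:
  "(cmod omega)\<^sup>2 = 3" "(cmod (1 - omega))\<^sup>2 = 3"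
  "(cmod (1 + omega))\<^sup>2 = 5" "(cmod (2 - omega))\<^sup>2 = 5"
  using cmod_Z_omega_square[of 0 1] cmod_Z_omega_square[of 1 "-1"]
    cmod_Z_omega_square[of 1 1] cmod_Z_omega_square[of 2 "-1"] by simp_all

section \<open>Sums of two and of three unit fractions\<close>

definition two_unit_fractions :: "complex \<Rightarrow> bool" where
  "two_unit_fractions z \<longleftrightarrow> (\<exists>b\<in>Z_omega - {0}. \<exists>c\<in>Z_omega - {0}. z = 1 / b + 1 / c)"

definition three_unit_fractions :: "complex \<Rightarrow> bool" where
  "three_unit_fractions z \<longleftrightarrow> (\<exists>a\<in>Z_omega - {0}. two_unit_fractions (z - 1 / a))"

lemma three_unit_fractionsI:
  assumes "a \<in> Z_omega" "b \<in> Z_omega" "c \<in> Z_omega" "a \<noteq> 0" "b \<noteq> 0" "c \<noteq> 0"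
    and "z = 1 / a + 1 / b + 1 / c"
  shows "three_unit_fractions z"
  unfolding three_unit_fractions_def two_unit_fractions_def
proof (intro bexI)
  show "z - 1 / a = 1 / b + 1 / c" using assms(7) by simp
qed (use assms in auto)

text \<open>Negating all three denominators flips the sign, which allows residues modulo 4 to be
  treated up to sign.\<close>

lemma three_unit_fractions_uminus:
  assumes "three_unit_fractions (- z)"
  shows "three_unit_fractions z"
proof -
  obtain a b c where *: "a \<in> Z_omega" "b \<in> Z_omega" "c \<in> Z_omega" "a \<noteq> 0" "b \<noteq> 0" "c \<noteq> 0"
    and "- z - 1 / a = 1 / b + 1 / c"
    using assms unfolding three_unit_fractions_def two_unit_fractions_def by auto
  then have "- z = 1 / a + 1 / b + 1 / c"
    by (simp add: algebra_simps)
  then have "z = - (1 / a + 1 / b + 1 / c)"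
    by (metis add.inverse_inverse)
  then have "z = 1 / - a + 1 / - b + 1 / - c"
    by simp
  then show ?thesis
    by (rule three_unit_fractionsI[rotated 6]) (use * in auto)
qed

lemma two_unit_fractions_inverse:
  assumes "x \<in> Z_omega" "x \<noteq> 0"
  shows "two_unit_fractions (1 / x)"
  unfolding two_unit_fractions_def
proof (intro bexI)
  show "1 / x = 1 / (2 * x) + 1 / (2 * x)" by simp
qed (use assms in auto)

text \<open>Expanding by \<open>t\<close> turns the numerator into \<open>d + e\<close>, and each
  summand cancels one factor of the denominator. The condition \<open>d + e \<noteq> 0\<close> makes
  \<open>t\<close> and \<open>r\<close> nonzero.\<close>

lemma two_unit_fractions_divisors:
  assumes "d \<in> Z_omega" "e \<in> Z_omega" "k \<in> Z_omega" "t \<in> Z_omega"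
    and "d * e * k \<noteq> 0" "d + e \<noteq> 0" "d + e = r * t"
  shows "two_unit_fractions (r / (d * e * k))"
proof -
  have nz: "d \<noteq> 0" "e \<noteq> 0" "k \<noteq> 0" "t \<noteq> 0" "r \<noteq> 0"
    using assms by auto
  have "r / (d * e * k) = (r * t) / (d * e * k * t)"
    using nz by simp
  also have "\<dots> = (d + e) / (d * e * k * t)"
    by (simp add: assms(7))
  also have "\<dots> = 1 / (t * k * e) + 1 / (t * k * d)"
    using nz by (simp add: divide_simps)
  finally show ?thesis
    unfolding two_unit_fractions_def using assms(1-4) nz
    by (intro bexI[of _ "t * k * e"] bexI[of _ "t * k * d"]) simp_all
qed

text \<open>The divisor pair is \<open>- \<epsilon>\<close> and \<open>d\<close>; a second factor
  \<open>- \<epsilon>\<close>, attached to \<open>k\<close>, restores the denominator. The condition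
  \<open>d \<noteq> \<epsilon>\<close> keeps the sum of the pair nonzero.\<close>

lemma two_unit_fractions_unit_residue:
  assumes "d \<in> Z_omega" "k \<in> Z_omega" "t \<in> Z_omega" "\<epsilon> \<in> {1, - 1}"
    and "d * k \<noteq> 0" "d \<noteq> \<epsilon>" "d = r * t + \<epsilon>"
  shows "two_unit_fractions (r / (d * k))"
proof -
  have "\<epsilon> * \<epsilon> = 1" using assms(4) by auto
  then have "- \<epsilon> * d * (- \<epsilon> * k) = d * k" by algebra
  moreover have "two_unit_fractions (r / (- \<epsilon> * d * (- \<epsilon> * k)))"
    by (rule two_unit_fractions_divisors[of _ _ _ t]) (use assms in auto)
  ultimately show ?thesis by metis
qed

section \<open>Residues modulo the primes of norm 3 and 5\<close>

text \<open>Modulo \<open>r\<close>, \<open>omega\<close> is congruent to the integer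
  \<open>i\<close>, so every element is congruent to an integer; that integer can be reduced modulo
  \<open>p\<close>, a multiple of \<open>r\<close>.\<close>

lemma residue_prime_norm:
  assumes z: "z \<in> Z_omega" and "r \<in> Z_omega" "r' \<in> Z_omega" "w \<in> Z_omega"
    and norm: "r * r' = of_int p" and omega: "omega = of_int i + r * w" and "0 < p"
  obtains t j where "t \<in> Z_omega" "0 \<le> j" "j < p" "z = r * t + of_int j"
proof -
  obtain x y :: int where xy: "z = of_int x + of_int y * omega"
    using z by (auto simp: Z_omega_def)
  define m where "m = (x + y * i) div p"
  define j where "j = (x + y * i) mod p"
  have "x + y * i = p * m + j"
    by (simp add: m_def j_def)
  then have "of_int x + of_int y * of_int i = (of_int p * of_int m + of_int j :: complex)"
    by (metis of_int_add of_int_mult)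
  then have "z = r * (r' * of_int m + of_int y * w) + of_int j"
    using norm omega unfolding xy by algebra
  moreover have "r' * of_int m + of_int y * w \<in> Z_omega"
    using assms by simp
  ultimately show ?thesis
    using that[of "r' * of_int m + of_int y * w" j] \<open>0 < p\<close> by (simp add: j_def)
qed

lemma residue_norm_3:
  assumes "z \<in> Z_omega" "p \<in> {omega, 1 - omega}"
  obtains t \<epsilon> where "t \<in> Z_omega" "\<epsilon> \<in> {0, 1, - 1}" "z = p * t + \<epsilon>"
proof -
  have "p * (1 - p) = omega - omega * omega"
    using assms(2) by (elim insertE emptyE; hypsubst) (simp_all add: algebra_simps)
  then have norm: "p * (1 - p) = of_int 3" "1 - p \<in> Z_omega" "p \<in> Z_omega"
    using assms(2) by (auto simp: omega_square)
  have "\<exists>i w. w \<in> Z_omega \<and> omega = of_int i + p * w"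
    using assms(2)
  proof (elim insertE emptyE)
    assume "p = omega"
    then show ?thesis by (intro exI[of _ 0] exI[of _ 1]) auto
  next
    assume "p = 1 - omega"
    then show ?thesis by (intro exI[of _ 1] exI[of _ "- 1"]) auto
  qed
  then obtain i w where w: "w \<in> Z_omega" "omega = of_int i + p * w"
    by blast
  obtain t j where t: "t \<in> Z_omega" "0 \<le> j" "j < 3" "z = p * t + of_int j"
    using residue_prime_norm[OF assms(1) norm(3,2) w(1) norm(1) w(2)] by auto
  then consider "j = 0" | "j = 1" | "j = 2" by linarith
  then show ?thesis
  proof cases
    case 3
    \<comment> \<open>The residue 2 becomes -1 by subtracting 3 =
      \<open>p * (1 - p)\<close>.\<close>
    have "z = p * (t + (1 - p)) + - 1"
      using t(4) norm(1) unfolding 3 by (simp add: algebra_simps)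
    then show ?thesis using that[of "t + (1 - p)" "- 1"] t norm by auto
  qed (use that[of t "of_int j"] t in auto)
qed

text \<open>Both choices of \<open>q\<close> have trace 3, so \<open>3 - q\<close> is the conjugate
  and the product is the norm.\<close>

lemma norm_5_cofactor:
  assumes "q \<in> {1 + omega, 2 - omega}"
  shows "q * (3 - q) = 5" "3 - q \<in> Z_omega" "q \<in> Z_omega"
proof -
  have "q * (3 - q) = 2 + omega - omega * omega"
    using assms by (elim insertE emptyE; hypsubst) (simp_all add: algebra_simps)
  then show "q * (3 - q) = 5" "3 - q \<in> Z_omega" "q \<in> Z_omega"
    using assms by (auto simp: omega_square)
qed

lemma residue_norm_5:
  assumes "z \<in> Z_omega" "q \<in> {1 + omega, 2 - omega}"
  obtains t \<epsilon> where "t \<in> Z_omega" "\<epsilon> \<in> {0, 1, - 1, 2, - 2}" "z = q * t + \<epsilon>"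
proof -
  note norm = norm_5_cofactor[OF assms(2)]
  have "\<exists>i w. w \<in> Z_omega \<and> omega = of_int i + q * w"
    using assms(2)
  proof (elim insertE emptyE)
    assume "q = 1 + omega"
    then show ?thesis by (intro exI[of _ "- 1"] exI[of _ 1]) auto
  next
    assume "q = 2 - omega"
    then show ?thesis by (intro exI[of _ 2] exI[of _ "- 1"]) auto
  qed
  then obtain i w where w: "w \<in> Z_omega" "omega = of_int i + q * w"
    by blast
  have "q * (3 - q) = of_int 5" using norm(1) by simp
  then obtain t j where t: "t \<in> Z_omega" "0 \<le> j" "j < 5" "z = q * t + of_int j"
    using residue_prime_norm[OF assms(1) norm(3,2) w(1) _ w(2)] by auto
  then consider "j \<in> {0, 1, 2}" | "j \<in> {3, 4}" by force
  then show ?thesis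
  proof cases
    case 1
    then show ?thesis using that[of t "of_int j"] t by auto
  next
    case 2
    \<comment> \<open>The residues 3 and 4 are moved to -2 and -1, so that the residues are
      symmetric under sign.\<close>
    have "z = q * (t + (3 - q)) + (of_int j - 5)"
      using t(4) norm(1) by (simp add: algebra_simps)
    moreover have "of_int j - 5 \<in> {0, 1, - 1, 2, - 2 :: complex}"
      using 2 by auto
    ultimately show ?thesis using that[of "t + (3 - q)" "of_int j - 5"] t norm by auto
  qed
qed

section \<open>Two-term decompositions with numerators of norm 3, 5 and 15\<close>

text \<open>Every residue modulo \<open>p\<close> is zero or a unit: either \<open>p\<close> cancels
  against \<open>u\<close>, or \<open>u\<close> is paired with a unit. The bound
  \<open>1 < cmod u\<close> prevents \<open>u\<close> from being that unit itself.\<close>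

lemma two_unit_fractions_norm_3:
  assumes "u \<in> Z_omega" "v \<in> Z_omega" "v \<noteq> 0" "1 < cmod u" "p \<in> {omega, 1 - omega}"
  shows "two_unit_fractions (p / (u * v))"
proof -
  have "u \<noteq> 0" using assms(4) by auto
  obtain t \<epsilon> where t: "t \<in> Z_omega" "\<epsilon> \<in> {0, 1, - 1}" "u = p * t + \<epsilon>"
    using residue_norm_3[OF assms(1,5)] .
  show ?thesis
  proof (cases "\<epsilon> = 0")
    case True
    then have "p / (u * v) = 1 / (t * v)" "t * v \<noteq> 0"
      using t(3) \<open>u \<noteq> 0\<close> \<open>v \<noteq> 0\<close> by auto
    then show ?thesis using two_unit_fractions_inverse[of "t * v"] t assms by auto
  next
    case False
    then show ?thesis
      by (intro two_unit_fractions_unit_residue[OF assms(1,2) t(1) _ _ _ t(3)])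
        (use assms(3,4) t(2) \<open>u \<noteq> 0\<close> in auto)
  qed
qed

lemma cmod_mult_gt_1:
  assumes "u \<in> Z_omega" "v \<in> Z_omega" "v \<noteq> 0" "1 < cmod u"
  shows "1 < cmod (u * v)"
  using mult_less_le_imp_less[OF assms(4) cmod_Z_omega_ge_1[OF assms(2,3)]]
  by (simp add: norm_mult)

text \<open>By \<open>u + v = q * s\<close>, \<open>u * v\<close> is congruent to minus the square
  of \<open>u\<close> modulo \<open>q\<close>. If \<open>u\<close> has residue 2 or -2, this is -4,
  hence 1, and \<open>u * v\<close> takes the role that \<open>u\<close> has for the residues 1 and
  -1.\<close>

lemma two_unit_fractions_norm_5:
  assumes "u \<in> Z_omega" "v \<in> Z_omega" "k \<in> Z_omega" "v \<noteq> 0" "k \<noteq> 0" "1 < cmod u"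
    and "q \<in> {1 + omega, 2 - omega}" "s \<in> Z_omega" "u + v = q * s"
  shows "two_unit_fractions (q / (u * v * k))"
proof -
  note norm = norm_5_cofactor[OF assms(7)]
  have "u \<noteq> 0" using assms(6) by auto
  obtain t \<epsilon> where t: "t \<in> Z_omega" "\<epsilon> \<in> {0, 1, - 1, 2, - 2}" "u = q * t + \<epsilon>"
    using residue_norm_5[OF assms(1,7)] .
  then consider "\<epsilon> = 0" | "\<epsilon> \<in> {1, - 1}" | "\<epsilon> * \<epsilon> = 4" by force
  then show ?thesis
  proof cases
    case 1
    then have "q / (u * v * k) = 1 / (t * v * k)" "t * v * k \<noteq> 0"
      using t(3) \<open>u \<noteq> 0\<close> assms(4,5) by auto
    then show ?thesis using two_unit_fractions_inverse[of "t * v * k"] t assms by auto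
  next
    case 2
    then have "two_unit_fractions (q / (u * (v * k)))"
      by (intro two_unit_fractions_unit_residue[OF _ _ t(1) _ _ _ t(3)])
        (use assms(1-6) \<open>u \<noteq> 0\<close> in auto)
    then show ?thesis by (simp add: mult.assoc)
  next
    case 3
    have "\<epsilon> \<in> Z_omega" using t(2) by auto
    \<comment> \<open>The quotient of \<open>u * v - 1\<close> by \<open>q\<close>: expand the
      product and write -4 as \<open>1 - q * (3 - q)\<close>.\<close>
    define x where "x = u * s - q * t * t - 2 * \<epsilon> * t - (3 - q)"
    have v: "v = q * s - u"
      using assms(9) by (simp add: algebra_simps)
    have "u * v - (q * x + 1) = (q * (3 - q) - 5) - (\<epsilon> * \<epsilon> - 4)"
      unfolding x_def v t(3) by (simp add: algebra_simps)
    then have "u * v = q * x + 1"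
      using 3 norm(1) by simp
    moreover have "x \<in> Z_omega"
      using assms(1,8) norm(2,3) t(1) \<open>\<epsilon> \<in> Z_omega\<close> by (simp add: x_def)
    moreover have "u * v \<noteq> 1" "u * v * k \<noteq> 0" "u * v \<in> Z_omega"
      using cmod_mult_gt_1[OF assms(1,2,4,6)] assms(1,2,4,5) \<open>u \<noteq> 0\<close> by auto
    ultimately show ?thesis
      using assms(3) by (intro two_unit_fractions_unit_residue[of _ _ x 1]) simp_all
  qed
qed

text \<open>Since \<open>q - p = 1\<close>, congruences modulo \<open>p\<close> and \<open>q\<close>
  to the same value combine to one modulo \<open>p * q\<close>. If neither prime divides
  \<open>n\<close>, comparing the residues \<epsilon> and \<delta> of \<open>n\<close> decides which
  of \<open>n\<close>, \<open>a\<close>, \<open>n * a\<close> is congruent to a unit.\<close>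

lemma two_unit_fractions_norm_15:
  assumes n: "n \<in> Z_omega" and a: "a \<in> Z_omega" "a \<notin> {0, 1, - 1}" and norm: "5 < (cmod n)\<^sup>2"
    and eq: "4 * a = n + (1 - omega) * (2 - omega)"
  shows "two_unit_fractions ((1 - omega) * (2 - omega) / (n * a))"
proof -
  define p where "p = 1 - omega"
  define q where "q = 2 - omega"
  have pq: "p \<in> {omega, 1 - omega}" "q \<in> {1 + omega, 2 - omega}" "q = p + 1"
    by (simp_all add: p_def q_def)
  have Z [simp]: "p \<in> Z_omega" "q \<in> Z_omega"
    by (simp_all add: p_def q_def)
  have p3: "p * (1 - p) = 3"
    using omega_square by (simp add: p_def algebra_simps)
  have q5: "q * (3 - q) = 5"
    using norm_5_cofactor[OF pq(2)] by simp
  have eq': "4 * a = n + p * q"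
    using eq by (simp add: p_def q_def)
  have nz: "p \<noteq> 0" "q \<noteq> 0" "n \<noteq> 0" "a \<noteq> 0"
    using p3 q5 norm a by auto
  have n1: "1 < cmod n"
  proof (rule ccontr)
    assume "\<not> 1 < cmod n"
    then have "(cmod n)\<^sup>2 \<le> 1\<^sup>2" by (intro power_mono) auto
    then show False using norm by simp
  qed
  obtain t \<epsilon> where t: "t \<in> Z_omega" "\<epsilon> \<in> {0, 1, - 1}" "n = p * t + \<epsilon>"
    using residue_norm_3[OF n pq(1)] .
  obtain s \<delta> where s: "s \<in> Z_omega" "\<delta> \<in> {0, 1, - 1, 2, - 2}" "n = q * s + \<delta>"
    using residue_norm_5[OF n pq(2)] .
  \<comment> \<open>Here 4 is read as \<open>1 + p * (1 - p)\<close>, and for the next congruence as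
    \<open>q * (3 - q) - 1\<close>.\<close>
  have a_mod_p: "a = p * (t + q - (1 - p) * a) + \<epsilon>"
    using eq' t(3) p3 by algebra
  have a_mod_q: "a = q * ((3 - q) * a - s - p) - \<delta>"
    using eq' s(3) q5 by algebra
  have \<epsilon>\<delta>: "\<epsilon> \<in> Z_omega" "\<delta> \<in> Z_omega" using t(2) s(2) by auto
  note crt = two_unit_fractions_unit_residue[where r = "p * q"]
  have "two_unit_fractions (p * q / (n * a))"
  proof (cases "\<epsilon> = 0")
    case True
    define b where "b = t + q - (1 - p) * a"
    have n': "n = p * t" and a': "a = p * b" and b: "b \<in> Z_omega"
      using t a_mod_p True \<open>a \<in> Z_omega\<close> by (auto simp: b_def)
    have "(cmod n)\<^sup>2 = 3 * (cmod t)\<^sup>2"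
      unfolding n' using cmod_square_omega_factors(2)
      by (simp add: norm_mult power_mult_distrib p_def)
    then have t1: "1 < cmod t"
      using norm by (intro power_less_imp_less_base[of 1 2]) auto
    have "4 * b = t + q"
      using eq' nz(1) unfolding n' a' by algebra
    \<comment> \<open>After cancelling \<open>p\<close>, the relation \<open>4 * b = t + q\<close>
      gives \<open>t + b = 5 * b - q\<close>, a multiple of \<open>q\<close>; the problem is reduced
      to norm 5.\<close>
    then have sum: "t + b = q * ((3 - q) * b - 1)"
      using q5 by algebra
    have "two_unit_fractions (q / (t * b * p))"
      by (rule two_unit_fractions_norm_5[OF _ _ _ _ _ _ _ _ sum]) (use t(1) b t1 nz a' pq(2) in auto)
    moreover have "p * q / (n * a) = q / (t * b * p)"
      unfolding n' a' using nz by (simp add: divide_simps)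
    ultimately show ?thesis by simp
  next
    case eps: False
    then have eps2: "\<epsilon> \<in> {1, - 1}" "\<epsilon> * \<epsilon> = 1" using t(2) by auto
    from s(2) consider "\<delta> = 0" | "\<delta> = \<epsilon>" | "\<delta> = - \<epsilon>" | "\<delta> * \<delta> = 4"
      using eps2 by force
    then show ?thesis
    proof cases
      case 1
      define b where "b = (3 - q) * a - s - p"
      have n': "n = q * s" and a': "a = q * b" and b: "b \<in> Z_omega"
        using s a_mod_q 1 \<open>a \<in> Z_omega\<close> by (auto simp: b_def)
      have "(cmod n)\<^sup>2 = 5 * (cmod s)\<^sup>2"
        unfolding n' using cmod_square_omega_factors(4)
        by (simp add: norm_mult power_mult_distrib q_def)
      \<comment> \<open>The bound 5 on the squared modulus of \<open>n\<close> is exactly what makes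
        the cofactor of \<open>q\<close> larger than a unit.\<close>
      then have "1 < cmod s"
        using norm by (intro power_less_imp_less_base[of 1 2]) auto
      then have "two_unit_fractions (p / (s * (q * b)))"
        using two_unit_fractions_norm_3[of s "q * b" p] s b a' nz pq by auto
      moreover have "p * q / (n * a) = p / (s * (q * b))"
        unfolding n' a' using nz by (simp add: divide_simps)
      ultimately show ?thesis by simp
    next
      case 2
      have "n \<noteq> \<epsilon>"
        using n1 eps2(1) by auto
      \<comment> \<open>Multiply \<open>n - \<epsilon>\<close> by \<open>q - p = 1\<close>,
        inserting \<open>p * t\<close> in one term and \<open>q * s\<close> in the other. The later
        cases combine their quotients in the same way.\<close>
      moreover have "n = p * q * (t - s) + \<epsilon>"
        using t(3) s(3) 2 pq(3) by algebra
      ultimately show ?thesis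
        using n a(1) t(1) s(1) eps2(1) nz by (intro crt[of n a "t - s" \<epsilon>]) auto
    next
      case 3
      define x where "x = (t + q - (1 - p) * a) - ((3 - q) * a - s - p)"
      have "a = p * q * x + \<epsilon>"
        using a_mod_p a_mod_q 3 pq(3) unfolding x_def by algebra
      moreover have "x \<in> Z_omega"
        using a(1) t(1) s(1) by (simp add: x_def)
      moreover have "a \<noteq> \<epsilon>"
        using a(2) eps2(1) by auto
      ultimately have "two_unit_fractions (p * q / (a * n))"
        using n a(1) eps2(1) nz by (intro crt[of a n x \<epsilon>]) auto
      then show ?thesis by (simp add: mult.commute)
    next
      case 4
      \<comment> \<open>\<open>y\<close> and \<open>z\<close> are the quotients of
        \<open>n * a - 1\<close> by \<open>p\<close> and \<open>q\<close>: the residues multiply to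
        \<open>\<epsilon> * \<epsilon> = 1\<close> and to
        \<open>- \<delta> * \<delta> = - 4\<close>, which is 1 modulo \<open>q\<close>.\<close>
      define y where "y = t * a + \<epsilon> * (t + q - (1 - p) * a)"
      define z where "z = s * a + \<delta> * ((3 - q) * a - s - p) - (3 - q)"
      have "n * a = p * y + 1"
        using t(3) a_mod_p eps2(2) unfolding y_def by algebra
      moreover have "n * a = q * z + 1"
        using s(3) a_mod_q 4 q5 unfolding z_def by algebra
      ultimately have "n * a = p * q * (y - z) + 1"
        using pq(3) by algebra
      moreover have "y - z \<in> Z_omega"
        using a(1) t(1) s(1) \<epsilon>\<delta> by (simp add: y_def z_def)
      moreover have "n * a \<noteq> 1"
        using cmod_mult_gt_1[OF n a(1) nz(4) n1] by auto
      ultimately have "two_unit_fractions (p * q / (n * a * 1))"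
        using n a(1) nz by (intro crt[of "n * a" 1 "y - z" 1]) auto
      then show ?thesis by simp
    qed
  qed
  then show ?thesis by (simp add: p_def q_def)
qed

section \<open>From a residue modulo 4 to three unit fractions\<close>

lemma three_unit_fractionsI2:
  assumes "a \<in> Z_omega" "a \<noteq> 0" "n \<noteq> 0" "4 * a = n + r" "two_unit_fractions (r / (n * a))"
  shows "three_unit_fractions (4 / n)"
proof -
  have "4 / n - 1 / a = (4 * a - n) / (n * a)"
    using assms(2,3) by (simp add: divide_simps)
  also have "4 * a - n = r"
    using assms(4) by simp
  finally show ?thesis
    using assms unfolding three_unit_fractions_def by (intro bexI[of _ a]) auto
qed

text \<open>Rationalises denominators, so that identities between explicit unit fractions become
  linear in \<open>omega\<close>.\<close>

lemma inverse_cofactor: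
  fixes u u' :: complex
  assumes "u * u' = numeral k"
  shows "u \<noteq> 0" "1 / u = u' / numeral k"
proof -
  show "u \<noteq> 0" using assms by auto
  moreover have "u' \<noteq> 0" using assms by auto
  ultimately show "1 / u = u' / numeral k"
    unfolding assms[symmetric] by simp
qed

text \<open>If \<open>r\<close> has norm at most 5, the size of \<open>n\<close> excludes
  \<open>a = 0\<close>, where \<open>n = - r\<close>. The \<open>r\<close> of norm 15 escapes this
  bound; there \<open>a\<close> equal to 0, 1, -1 means \<open>n\<close> equal to
  \<open>1 + 2 * omega\<close>, \<open>5 + 2 * omega\<close>, \<open>- 3 + 2 * omega\<close>, which
  are settled explicitly.\<close>

lemma three_unit_fractions_residue:
  assumes n: "n \<in> Z_omega" "5 < (cmod n)\<^sup>2" and a: "a \<in> Z_omega" "4 * a = n + r"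
    and r: "r \<in> {1, omega, 1 - omega, 1 + omega, 2 - omega, (1 - omega) * (2 - omega)}"
  shows "three_unit_fractions (4 / n)"
proof (cases "r = (1 - omega) * (2 - omega)")
  case True
  have r': "r = - 1 - 2 * omega"
    using omega_square unfolding True by algebra
  \<comment> \<open>For the unit values \<open>a = \<epsilon>\<close> the divisor \<open>a\<close> satisfies \<open>a - \<epsilon> = 0\<close>, which gives no
    decomposition; the solutions for these values and \<open>a = 0\<close> come from a computer search.\<close>
  consider "a = 0" | "a = 1" | "a = - 1" | "a \<notin> {0, 1, - 1}" by blast
  then show ?thesis
  proof cases
    case 1
    then have n_eq: "n = 1 + 2 * omega"
      using a(2) r' by (simp add: algebra_simps)
    have "(1 + 2 * omega) * (3 - 2 * omega) = 15"
      using omega_square by algebra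
    note d0 = inverse_cofactor[OF this]
    have "(- 2 + omega) * (- 1 - omega) = 5"
      using omega_square by algebra
    note d1 = inverse_cofactor[OF this]
    have "(- 1 + omega) * (- omega) = 3"
      using omega_square by algebra
    note d2 = inverse_cofactor[OF this]
    have "4 / (1 + 2 * omega) = 4 * (1 / (1 + 2 * omega))"
      by simp
    also have "\<dots> = 1 / 1 + 1 / (- 2 + omega) + 1 / (- 1 + omega)"
      unfolding d0(2) d1(2) d2(2) by (simp add: field_simps)
    finally show ?thesis
      unfolding n_eq by (rule three_unit_fractionsI[rotated 6]) (use d1(1) d2(1) in simp_all)
  next
    case 2
    then have n_eq: "n = 5 + 2 * omega"
      using a(2) r' by (simp add: algebra_simps)
    have "(5 + 2 * omega) * (7 - 2 * omega) = 47"
      using omega_square by algebra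
    note d0 = inverse_cofactor[OF this]
    \<comment> \<open>\<open>- 1 + 2 * omega\<close> is the square root of -11, so its cofactor is
      its negative.\<close>
    have "(- 1 + 2 * omega) * (1 - 2 * omega) = 11"
      using omega_square by algebra
    note d1 = inverse_cofactor[OF this]
    have "(34 - 24 * omega) * (10 + 24 * omega) = 2068"
      using omega_square by algebra
    note d2 = inverse_cofactor[OF this]
    have "4 / (5 + 2 * omega) = 4 * (1 / (5 + 2 * omega))"
      by simp
    also have "\<dots> = 1 / 2 + 1 / (- 1 + 2 * omega) + 1 / (34 - 24 * omega)"
      unfolding d0(2) d1(2) d2(2) by (simp add: field_simps)
    finally show ?thesis
      unfolding n_eq by (rule three_unit_fractionsI[rotated 6]) (use d1(1) d2(1) in simp_all)
  next
    case 3
    then have n_eq: "n = - 3 + 2 * omega"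
      using a(2) r' by (simp add: algebra_simps)
    have "(- 3 + 2 * omega) * (- 1 - 2 * omega) = 15"
      using omega_square by algebra
    note d0 = inverse_cofactor[OF this]
    have "omega * (1 - omega) = 3"
      using omega_square by algebra
    note d1 = inverse_cofactor[OF this]
    have "(1 + omega) * (2 - omega) = 5"
      using omega_square by algebra
    note d2 = inverse_cofactor[OF this]
    have "4 / (- 3 + 2 * omega) = 4 * (1 / (- 3 + 2 * omega))"
      by simp
    also have "\<dots> = 1 / (- 1) + 1 / omega + 1 / (1 + omega)"
      unfolding d0(2) d1(2) d2(2) by (simp add: field_simps)
    finally show ?thesis
      unfolding n_eq by (rule three_unit_fractionsI[rotated 6]) (use d1(1) d2(1) in simp_all)
  next
    case 4
    then show ?thesis
      using two_unit_fractions_norm_15[OF n(1) a(1) _ n(2)] a True n(2)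
      by (intro three_unit_fractionsI2[OF a(1) _ _ a(2)]) auto
  qed
next
  case False
  then consider (unit) "r = 1" | (norm_3) "r \<in> {omega, 1 - omega}" | (norm_5) "r \<in> {1 + omega, 2 - omega}"
    using r by blast
  note r_cases = this
  have "n \<noteq> 0" using n(2) by auto
  have n1: "1 < cmod n"
    using n(2) by (intro power_less_imp_less_base[of 1 2]) auto
  have "a \<noteq> 0"
  proof
    assume "a = 0"
    then have "n = - r"
      using a(2) by (simp add: eq_neg_iff_add_eq_0)
    then have "(cmod n)\<^sup>2 = (cmod r)\<^sup>2" by simp
    moreover have "(cmod r)\<^sup>2 \<le> 5"
      using r False by (elim insertE emptyE) (simp_all add: cmod_square_omega_factors)
    ultimately show False using n(2) by linarith
  qed
  have "two_unit_fractions (r / (n * a))"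
    using r_cases
  proof cases
    case unit
    then show ?thesis
      using two_unit_fractions_inverse[of "n * a"] n(1) a(1) \<open>n \<noteq> 0\<close> \<open>a \<noteq> 0\<close> by simp
  next
    case norm_3
    then show ?thesis
      using two_unit_fractions_norm_3[OF n(1) a(1) \<open>a \<noteq> 0\<close> n1] by blast
  next
    case norm_5
    \<comment> \<open>The left side is \<open>5 * a - r\<close>, and \<open>r\<close> divides
      5.\<close>
    have "n + a = r * ((3 - r) * a - 1)"
      using a(2) norm_5_cofactor(1)[OF norm_5] by algebra
    then show ?thesis
      using two_unit_fractions_norm_5[OF n(1) a(1) _ \<open>a \<noteq> 0\<close> _ n1 norm_5, of 1 "(3 - r) * a - 1"]
        norm_5_cofactor(2)[OF norm_5] a(1) by simp
  qed
  then show ?thesis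
    using three_unit_fractionsI2[OF a(1) \<open>a \<noteq> 0\<close> \<open>n \<noteq> 0\<close> a(2)] by blast
qed

section \<open>Residue classes modulo 4\<close>

text \<open>Of the sixteen classes modulo 4, four are divisible by 2; the other twelve are the
  classes of the six values of \<open>r\<close> and their negatives.\<close>

lemma Z_omega_residue_4:
  assumes "n \<in> Z_omega"
  obtains m where "m \<in> Z_omega" "n = 2 * m"
  | a r where "a \<in> Z_omega" "4 * a = n + r \<or> 4 * a = - n + r"
      "r \<in> {1, omega, 1 - omega, 1 + omega, 2 - omega, (1 - omega) * (2 - omega)}"
proof -
  obtain x y :: int where n: "n = of_int x + of_int y * omega"
    using assms by (auto simp: Z_omega_def)
  define c where "c = of_int (x div 4) + of_int (y div 4) * omega"
  have c: "c \<in> Z_omega" by (simp add: c_def)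
  have div_mod: "of_int x = (4 * of_int (x div 4) + of_int (x mod 4) :: complex)" for x
    by (metis mult_div_mod_eq of_int_add of_int_mult of_int_numeral)
  have nc: "n = 4 * c + (of_int (x mod 4) + of_int (y mod 4) * omega)"
    unfolding n c_def div_mod[of x] div_mod[of y] by (simp add: algebra_simps)
  have mod_4: "z mod 4 = 0 \<or> z mod 4 = 1 \<or> z mod 4 = 2 \<or> z mod 4 = 3" for z :: int
    by presburger
  consider "x mod 4 = 0" "y mod 4 = 0" | "x mod 4 = 0" "y mod 4 = 1"
    | "x mod 4 = 0" "y mod 4 = 2" | "x mod 4 = 0" "y mod 4 = 3"
    | "x mod 4 = 1" "y mod 4 = 0" | "x mod 4 = 1" "y mod 4 = 1"
    | "x mod 4 = 1" "y mod 4 = 2" | "x mod 4 = 1" "y mod 4 = 3"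
    | "x mod 4 = 2" "y mod 4 = 0" | "x mod 4 = 2" "y mod 4 = 1"
    | "x mod 4 = 2" "y mod 4 = 2" | "x mod 4 = 2" "y mod 4 = 3"
    | "x mod 4 = 3" "y mod 4 = 0" | "x mod 4 = 3" "y mod 4 = 1"
    | "x mod 4 = 3" "y mod 4 = 2" | "x mod 4 = 3" "y mod 4 = 3"
    using mod_4[of x] mod_4[of y] by (elim disjE; simp)
  \<comment> \<open>In the odd classes \<open>a\<close> is \<open>c\<close> or \<open>- c\<close>,
    according to the sign of \<open>n\<close>, plus a correction from the chosen representative
    \<open>r\<close>.\<close>
  then show thesis
  proof cases
    case 1
    then show thesis
      using that(1)[of "2 * c"] c
      by (simp add: nc omega_square algebra_simps)
  next
    case 2
    then show thesis
      using that(2)[of "- c" "omega"] c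
      by (simp add: nc omega_square algebra_simps)
  next
    case 3
    then show thesis
      using that(1)[of "2 * c + omega"] c
      by (simp add: nc omega_square algebra_simps)
  next
    case 4
    then show thesis
      using that(2)[of "c + omega" "omega"] c
      by (simp add: nc omega_square algebra_simps)
  next
    case 5
    then show thesis
      using that(2)[of "- c" "1"] c
      by (simp add: nc omega_square algebra_simps)
  next
    case 6
    then show thesis
      using that(2)[of "- c" "1 + omega"] c
      by (simp add: nc omega_square algebra_simps)
  next
    case 7
    then show thesis
      using that(2)[of c "(1 - omega) * (2 - omega)"] c
      by (simp add: nc omega_square algebra_simps)
  next
    case 8
    then show thesis
      using that(2)[of "- c - omega" "1 - omega"] c
      by (simp add: nc omega_square algebra_simps)
  next
    case 9
    then show thesis
      using that(1)[of "2 * c + 1"] c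
      by (simp add: nc omega_square algebra_simps)
  next
    case 10
    then show thesis
      using that(2)[of "c + 1" "2 - omega"] c
      by (simp add: nc omega_square algebra_simps)
  next
    case 11
    then show thesis
      using that(1)[of "2 * c + 1 + omega"] c
      by (simp add: nc omega_square algebra_simps)
  next
    case 12
    then show thesis
      using that(2)[of "- c - omega" "2 - omega"] c
      by (simp add: nc omega_square algebra_simps)
  next
    case 13
    then show thesis
      using that(2)[of "c + 1" "1"] c
      by (simp add: nc omega_square algebra_simps)
  next
    case 14
    then show thesis
      using that(2)[of "c + 1" "1 - omega"] c
      by (simp add: nc omega_square algebra_simps)
  next
    case 15
    then show thesis
      using that(2)[of "- c - 1 - omega" "(1 - omega) * (2 - omega)"] c
      by (simp add: nc omega_square algebra_simps)
  next
    case 16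
    then show thesis
      using that(2)[of "c + 1 + omega" "1 + omega"] c
      by (simp add: nc omega_square algebra_simps)
  qed
qed

theorem theorem14:
  fixes n :: complex
  assumes "n \<in> Z_omega - exceptional_set"
  shows "\<exists>a b c. a \<in> Z_omega \<and> b \<in> Z_omega \<and> c \<in> Z_omega \<and>
           a \<noteq> 0 \<and> b \<noteq> 0 \<and> c \<noteq> 0 \<and>
           4 / n = 1 / a + 1 / b + 1 / c"
proof -
  have n: "n \<in> Z_omega" and size: "n = 2 \<or> n = - 2 \<or> 5 < (cmod n)\<^sup>2"
    using assms unfolding exceptional_set_def by auto
  have "n \<noteq> 0" using size by auto
  have "three_unit_fractions (4 / n)"
    using n
  proof (cases rule: Z_omega_residue_4)
    case (1 m)
    then have "m \<noteq> 0" using \<open>n \<noteq> 0\<close> by auto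
    \<comment> \<open>For \<open>n = 2 * m\<close> the fraction is \<open>2 / m\<close>; one copy of
      \<open>1 / m\<close> is kept and the other is halved.\<close>
    then have "4 / n - 1 / m = 1 / m"
      using 1(2) by (simp add: divide_simps)
    then show ?thesis
      unfolding three_unit_fractions_def
      using two_unit_fractions_inverse[OF 1(1) \<open>m \<noteq> 0\<close>] 1(1) \<open>m \<noteq> 0\<close>
      by (intro bexI[of _ m]) auto
  next
    case (2 a r)
    show ?thesis
    \<comment> \<open>The alternatives of the residue lemma are not stated to be exclusive, so 2 and
      -2, which lack the norm bound, are treated here too, by 2 = 1 + 1/2 + 1/2.\<close>
    proof (cases "n = 2 \<or> n = - 2")
      case True
      then have "three_unit_fractions (4 / 2)"
        by (intro three_unit_fractionsI[of 1 2 2]) auto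
      then show ?thesis
        using True three_unit_fractions_uminus[of "- 2"] by auto
    next
      case False
      then have size: "5 < (cmod n)\<^sup>2" using size by blast
      from 2(2) show ?thesis
      proof
        assume "4 * a = n + r"
        then show ?thesis
          using three_unit_fractions_residue[OF n size 2(1) _ 2(3)] by blast
      next
        assume "4 * a = - n + r"
        then have "three_unit_fractions (4 / - n)"
          using three_unit_fractions_residue[of "- n", OF _ _ 2(1) _ 2(3)] n size by simp
        then show ?thesis
          using three_unit_fractions_uminus[of "4 / n"] by simp
      qed
    qed
  qed
  then show ?thesis
    unfolding three_unit_fractions_def two_unit_fractions_def
    by (auto simp: algebra_simps)
qed

end
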